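(* Let $L$ be a finite set of cardinality $k$ and let $f:L\times L\to L$ be a binary operator on $L$ with structure matrix $M=[M_1,\dots,M_k]\in\mathcal{L}_{k\times k^2}$, where $M_i\in\mathcal{L}_{k\times k}$ for $i=1,\dots,k$. Then $(L,f)$ is a lattice if and only if $M$ satisfies the following conditions: (i) $M\,\mathrm{diag}(\delta_k^1,\dots,\delta_k^k)=I_k$; (ii) $M W_{[k,k]}=M$; (iii) $M^2=M(I_k\otimes M)$; (iv) there exists $i\in\{1,\dots,k\}$ such that $M_i=I_k$.
   Context: All matrix products (including the power $M^2=M\ltimes M$) are semi-tensor products: for $A\in\mathbb{R}^{m\times n}$, $B\in\mathbb{R}^{p\times q}$ and $t=\mathrm{lcm}(n,p)$, $A\ltimes B:=(A\otimes I_{t/n})(B\otimes I_{t/p})$, where $\otimes$ is the Kronecker product; this is the usual product when $n=p$. Notation: $\delta_n^i$ is the $i$-th column of the identity matrix $I_n$; $\Delta_n$ is the set of columns of $I_n$; $\mathcal{L}_{m\times n}$ is the set of logical matrices, i.e. $m\times n$ matrices all of whose columns lie in $\Delta_m$; $\delta_m[i_1,\dots,i_n]:=[\delta_m^{i_1},\dots,\delta_m^{i_n}]$. $\mathrm{diag}(\delta_k^1,\dots,\delta_k^k)$ is the $k^2\times k$ block-diagonal matrix with diagonal blocks the column vectors $\delta_k^1,\dots,\delta_k^k$. The swap matrix $W_{[m,n]}\in\mathbb{R}^{mn\times mn}$ is $W_{[m,n]}=\delta_{mn}[1,m+1,\dots,(n-1)m+1,2,m+2,\dots,(n-1)m+2,\dots,m,2m,\dots,nm]$;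 it satisfies $W_{[m,n]}\ltimes X\ltimes Y=Y\ltimes X$ for columns $X\in\mathbb{R}^m$, $Y\in\mathbb{R}^n$. Structure matrix: the elements of $L$ are identified bijectively with the vectors $\delta_k^1,\dots,\delta_k^k$ (vector expression); the structure matrix of $f$ is the unique $M\in\mathcal{L}_{k\times k^2}$ such that, in vector expression, $f(x,y)=M\ltimes x\ltimes y$ for all $x,y\in L$. Lattice (definition used): a finite set $L$ with a binary operator $\vee$ is called a lattice if for all $x,y,z\in L$: $x\vee x=x$; $x\vee y=y\vee x$; $(x\vee y)\vee z=x\vee(y\vee z)$; and there exists $\mathbf{0}\in L$ with $w\vee\mathbf{0}=w$ for all $w\in L$. "$(L,f)$ is a lattice" means that these hold with $\vee=f$. *)

theory Defs
  imports Complex_Main "HOL-Library.FuncSet" "Jordan_Normal_Form.Matrix"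
begin

definition kron :: "real mat \<Rightarrow> real mat \<Rightarrow> real mat" (infixl \<open>\<otimes>\<^sub>K\<close> 72) where
  "A \<otimes>\<^sub>K B = mat (dim_row A * dim_row B) (dim_col A * dim_col B)
     (\<lambda>(i, j). A $$ (i div dim_row B, j div dim_col B) * B $$ (i mod dim_row B, j mod dim_col B))"

definition stp :: "real mat \<Rightarrow> real mat \<Rightarrow> real mat" (infixl \<open>\<ltimes>\<close> 70) where
  "A \<ltimes> B = (let t = lcm (dim_col A) (dim_row B) in
     (A \<otimes>\<^sub>K 1\<^sub>m (t div dim_col A)) * (B \<otimes>\<^sub>K 1\<^sub>m (t div dim_row B)))"

text \<open>The superscript of a delta vector is counted from 1, whereas \<^const>\<open>col\<close> counts from 0.\<close>

definition delta :: "nat \<Rightarrow> nat \<Rightarrow> real vec" where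
  "delta n i = col (1\<^sub>m n) (i - 1)"

definition Delta :: "nat \<Rightarrow> real vec set" where
  "Delta n = set (cols (1\<^sub>m n))"

definition logical_mats :: "nat \<Rightarrow> nat \<Rightarrow> real mat set" where
  "logical_mats m n = {A \<in> carrier_mat m n. set (cols A) \<subseteq> Delta m}"

definition delta_mat :: "nat \<Rightarrow> nat list \<Rightarrow> real mat" where
  "delta_mat m js = mat_of_cols m (map (delta m) js)"

text \<open>Vectors enter semi-tensor products as matrices with one column.\<close>

definition col_mat :: "real vec \<Rightarrow> real mat" where
  "col_mat v = mat_of_cols (dim_vec v) [v]"

definition diag_delta :: "nat \<Rightarrow> real mat" where
  "diag_delta k = diag_block_mat (map (\<lambda>i. col_mat (delta k i)) [1..<k+1])"

definition swap_mat :: "nat \<Rightarrow> nat \<Rightarrow> real mat" where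
  "swap_mat m n = delta_mat (m * n) (concat (map (\<lambda>i. map (\<lambda>j. j * m + i) [0..<n]) [1..<m+1]))"

definition block_row :: "nat \<Rightarrow> nat \<Rightarrow> (nat \<Rightarrow> real mat) \<Rightarrow> real mat" where
  "block_row m n B = mat_of_cols m (concat (map (\<lambda>i. cols (B i)) [1..<n+1]))"

definition vector_expression :: "'a set \<Rightarrow> ('a \<Rightarrow> real vec) \<Rightarrow> bool" where
  "vector_expression L \<phi> \<longleftrightarrow> bij_betw \<phi> L (Delta (card L))"

definition is_structure_matrix ::
  "'a set \<Rightarrow> ('a \<Rightarrow> real vec) \<Rightarrow> ('a \<Rightarrow> 'a \<Rightarrow> 'a) \<Rightarrow> real mat \<Rightarrow> bool" where
  "is_structure_matrix L \<phi> f M \<longleftrightarrow>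
     M \<in> logical_mats (card L) ((card L)\<^sup>2) \<and>
     (\<forall>x\<in>L. \<forall>y\<in>L. col_mat (\<phi> (f x y)) = M \<ltimes> col_mat (\<phi> x) \<ltimes> col_mat (\<phi> y))"

text \<open>Only the join operation is axiomatised, with a least element; this differs from the notions of
  lattice in the libraries.\<close>

definition is_lattice :: "'a set \<Rightarrow> ('a \<Rightarrow> 'a \<Rightarrow> 'a) \<Rightarrow> bool" where
  "is_lattice L f \<longleftrightarrow>
     finite L \<and> f \<in> L \<rightarrow> L \<rightarrow> L \<and>
     (\<forall>x\<in>L. f x x = x) \<and>
     (\<forall>x\<in>L. \<forall>y\<in>L. f x y = f y x) \<and>
     (\<forall>x\<in>L. \<forall>y\<in>L. \<forall>z\<in>L. f (f x y) z = f x (f y z)) \<and>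
     (\<exists>e\<in>L. \<forall>w\<in>L. f w e = w)"

end

theory Submission
  imports Defs
begin

text \<open>A logical matrix is determined by the function sending each column index to the row of its only
  nonzero entry, and products, Kronecker products and semi-tensor products act on these functions.
  Once \<open>M\<close> is given by \<open>h\<close>, numbering \<open>L\<close> by \<open>{..<k}\<close> turns \<open>f\<close> into
  \<open>(a, b) \<mapsto> h (a * k + b)\<close>, and the four matrix equations become, index by index, idempotence,
  commutativity, associativity and the existence of a left neutral element, which by commutativity
  is the same as a right neutral one.\<close>

section \<open>Logical matrices as functions on column indices\<close>

definition logical_mat :: "nat \<Rightarrow> nat \<Rightarrow> (nat \<Rightarrow> nat) \<Rightarrow> real mat" where
  "logical_mat m n h = mat m n (\<lambda>(i, j). if i = h j then 1 else 0)"

lemma dim_logical_mat [simp]: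
  "dim_row (logical_mat m n h) = m" "dim_col (logical_mat m n h) = n"
  by (simp_all add: logical_mat_def)

lemma index_logical_mat [simp]:
  "i < m \<Longrightarrow> j < n \<Longrightarrow> logical_mat m n h $$ (i, j) = (if i = h j then 1 else 0)"
  by (simp add: logical_mat_def)

lemma logical_mat_cong:
  assumes "\<And>j. j < n \<Longrightarrow> h j = h' j"
  shows "logical_mat m n h = logical_mat m n h'"
  by (rule eq_matI) (auto simp: assms)

text \<open>The bound puts row \<open>h j\<close> inside the matrix, where the left entry is 1, and
  this forces \<open>h' j = h j\<close>. A value outside the range would leave a zero column, from
  which it could not be recovered.\<close>

lemma logical_mat_eq_iff:
  assumes "\<And>j. j < n \<Longrightarrow> h j < m"
  shows "logical_mat m n h = logical_mat m n h' \<longleftrightarrow> (\<forall>j<n. h j = h' j)"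
proof
  assume eq: "logical_mat m n h = logical_mat m n h'"
  show "\<forall>j<n. h j = h' j"
  proof (intro allI impI)
    fix j assume j: "j < n"
    have "logical_mat m n h $$ (h j, j) = logical_mat m n h' $$ (h j, j)" by (simp add: eq)
    then show "h j = h' j" using assms[OF j] j by (simp split: if_splits)
  qed
qed (auto intro: logical_mat_cong)

lemma one_mat_eq_logical_mat: "1\<^sub>m n = logical_mat n n (\<lambda>j. j)"
  by (rule eq_matI) auto

text \<open>Column \<open>j\<close> of the right factor is the unit vector at \<open>h' j\<close>,
  so it selects that column of the left factor; in the sum only \<open>l = h' j\<close>
  survives.\<close>

lemma logical_mat_mult:
  assumes "\<And>j. j < q \<Longrightarrow> h' j < n"
  shows "logical_mat m n h * logical_mat n q h' = logical_mat m q (\<lambda>j. h (h' j))"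
proof (rule eq_matI)
  fix i j assume "i < dim_row (logical_mat m q (\<lambda>j. h (h' j)))"
    and "j < dim_col (logical_mat m q (\<lambda>j. h (h' j)))"
  then have ij: "i < m" "j < q" by auto
  have "(logical_mat m n h * logical_mat n q h') $$ (i, j) =
      (\<Sum>l\<in>{0..<n}. (if i = h l then 1 else 0) * (if l = h' j then 1 else 0))"
    using ij by (simp add: scalar_prod_def)
  also have "\<dots> = (\<Sum>l\<in>{0..<n}. if l = h' j then (if i = h l then 1 else 0) else 0)"
    by (rule sum.cong) auto
  also have "\<dots> = (if i = h (h' j) then 1 else 0)"
    using assms[OF ij(2)] by (simp add: sum.delta)
  finally show "(logical_mat m n h * logical_mat n q h') $$ (i, j) =
      logical_mat m q (\<lambda>j. h (h' j)) $$ (i, j)"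
    using ij by simp
qed auto

section \<open>Pairs coded as \<open>a * n + b\<close>\<close>

lemma mult_add_less:
  fixes a b m n :: nat
  assumes "a < m" "b < n"
  shows "a * n + b < m * n"
proof -
  have "a * n + b < Suc a * n" using assms by simp
  also have "\<dots> \<le> m * n" using assms by (intro mult_le_mono1) simp
  finally show ?thesis .
qed

lemma mod_less_of_less_mult:
  fixes j m n :: nat
  shows "j < m * n \<Longrightarrow> j mod n < n"
  by (cases n) auto

lemma all_less_mult_iff:
  fixes m n :: nat
  shows "(\<forall>j<m * n. P j) \<longleftrightarrow> (\<forall>a<m. \<forall>b<n. P (a * n + b))"
proof
  assume *: "\<forall>a<m. \<forall>b<n. P (a * n + b)"
  show "\<forall>j<m * n. P j"
  proof (intro allI impI)
    fix j assume "j < m * n"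
    then have "P ((j div n) * n + j mod n)"
      using * less_mult_imp_div_less mod_less_of_less_mult by blast
    then show "P j" by simp
  qed
qed (use mult_add_less in blast)

lemma eq_mult_add_iff:
  fixes i a b p :: nat
  assumes "b < p"
  shows "i = a * p + b \<longleftrightarrow> i div p = a \<and> i mod p = b"
  using assms by auto

section \<open>Kronecker and semi-tensor products of logical matrices\<close>

text \<open>Row and column indices code pairs by div and mod, and an entry is 1 exactly when both
  coordinates match. The bound on \<open>h'\<close> makes the value a valid code.\<close>

lemma kron_logical_mat:
  assumes "\<And>j. j < q \<Longrightarrow> h' j < p"
  shows "logical_mat m n h \<otimes>\<^sub>K logical_mat p q h' =
    logical_mat (m * p) (n * q) (\<lambda>j. h (j div q) * p + h' (j mod q))"
proof (rule eq_matI)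
  fix i j
  assume "i < dim_row (logical_mat (m * p) (n * q) (\<lambda>j. h (j div q) * p + h' (j mod q)))"
    and "j < dim_col (logical_mat (m * p) (n * q) (\<lambda>j. h (j div q) * p + h' (j mod q)))"
  then have ij: "i < m * p" "j < n * q" by auto
  note b = less_mult_imp_div_less[OF ij(1)] mod_less_of_less_mult[OF ij(1)]
    less_mult_imp_div_less[OF ij(2)] mod_less_of_less_mult[OF ij(2)]
  have "i = h (j div q) * p + h' (j mod q) \<longleftrightarrow> i div p = h (j div q) \<and> i mod p = h' (j mod q)"
    by (rule eq_mult_add_iff) (rule assms[OF b(4)])
  then show "(logical_mat m n h \<otimes>\<^sub>K logical_mat p q h') $$ (i, j) =
      logical_mat (m * p) (n * q) (\<lambda>j. h (j div q) * p + h' (j mod q)) $$ (i, j)"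
    using ij b by (simp add: kron_def)
qed (auto simp: kron_def)

lemma kron_one_left:
  assumes "\<And>j. j < q \<Longrightarrow> h j < p"
  shows "1\<^sub>m n \<otimes>\<^sub>K logical_mat p q h = logical_mat (n * p) (n * q) (\<lambda>j. (j div q) * p + h (j mod q))"
  unfolding one_mat_eq_logical_mat by (rule kron_logical_mat) (rule assms)

lemma kron_one_right:
  "logical_mat m n h \<otimes>\<^sub>K 1\<^sub>m q = logical_mat (m * q) (n * q) (\<lambda>j. h (j div q) * q + j mod q)"
  unfolding one_mat_eq_logical_mat by (rule kron_logical_mat) simp

text \<open>The lcm is \<open>n * r\<close>, so the left factor stays as it is and only the right
  one is enlarged by an identity of size \<open>r\<close>. All semi-tensor products below have this
  shape: \<open>r = k\<close> for \<open>M \<ltimes> M\<close> and for \<open>M\<close> times a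
  first argument, \<open>r = 1\<close> otherwise.\<close>

lemma stp_logical_mat_dvd:
  assumes "0 < n" "0 < r" "\<And>j. j < q \<Longrightarrow> h' j < n"
  shows "logical_mat m (n * r) h \<ltimes> logical_mat n q h' =
    logical_mat m (q * r) (\<lambda>j. h (h' (j div r) * r + j mod r))"
proof -
  have l: "lcm (n * r) n = n * r" by (simp add: lcm_proj1_if_dvd)
  have "logical_mat m (n * r) h \<ltimes> logical_mat n q h' =
      logical_mat m (n * r) h * logical_mat (n * r) (q * r) (\<lambda>j. h' (j div r) * r + j mod r)"
    using assms(1,2) by (simp add: stp_def Let_def l kron_one_right)
  also have "\<dots> = logical_mat m (q * r) (\<lambda>j. h (h' (j div r) * r + j mod r))"
    by (intro logical_mat_mult mult_add_less assms(3) less_mult_imp_div_less mod_less_of_less_mult)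
  finally show ?thesis .
qed

lemma stp_logical_mat_eq:
  assumes "0 < n" "\<And>j. j < q \<Longrightarrow> h' j < n"
  shows "logical_mat m n h \<ltimes> logical_mat n q h' = logical_mat m q (\<lambda>j. h (h' j))"
  using stp_logical_mat_dvd[of n 1 q h' m h] assms by simp

section \<open>Translating delta vectors, diagonal, swap and block matrices\<close>

lemma Delta_eq: "Delta n = unit_vec n ` {..<n}"
  by (auto simp: Delta_def cols_def)

lemma logical_mats_imp_logical_mat:
  assumes "A \<in> logical_mats m n"
  shows "\<exists>h. (\<forall>j<n. h j < m) \<and> A = logical_mat m n h"
proof -
  have A: "A \<in> carrier_mat m n" and c: "set (cols A) \<subseteq> Delta m"
    using assms by (auto simp: logical_mats_def)
  have "\<exists>i<m. col A j = unit_vec m i" if "j < n" for j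
  proof -
    have "col A j \<in> set (cols A)" using that A by (auto simp: cols_def)
    then show ?thesis using c by (auto simp: Delta_eq)
  qed
  then obtain h where h: "\<And>j. j < n \<Longrightarrow> h j < m \<and> col A j = unit_vec m (h j)" by metis
  have "A = logical_mat m n h"
  proof (rule eq_matI)
    fix i j assume "i < dim_row (logical_mat m n h)" "j < dim_col (logical_mat m n h)"
    then have ij: "i < m" "j < n" by auto
    have "A $$ (i, j) = col A j $ i" using A ij by simp
    also have "\<dots> = logical_mat m n h $$ (i, j)" using h[OF ij(2)] ij by simp
    finally show "A $$ (i, j) = logical_mat m n h $$ (i, j)" .
  qed (use A in auto)
  then show ?thesis using h by blast
qed

lemma col_mat_unit_vec: "i < n \<Longrightarrow> col_mat (unit_vec n i) = logical_mat n 1 (\<lambda>_. i)"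
  by (rule eq_matI) (auto simp: col_mat_def mat_of_cols_def)

lemma delta_eq_unit_vec: "i - 1 < n \<Longrightarrow> delta n i = unit_vec n (i - 1)"
  by (simp add: delta_def)

text \<open>The subtraction turns labels counted from 1 into rows counted from 0.\<close>

lemma delta_mat_eq_logical_mat:
  assumes "\<And>j. j < length js \<Longrightarrow> js ! j - 1 < m"
  shows "delta_mat m js = logical_mat m (length js) (\<lambda>j. js ! j - 1)"
  using assms by (intro eq_matI) (auto simp: delta_mat_def mat_of_cols_def delta_eq_unit_vec)

text \<open>Every block is a single column of height \<open>m\<close>, so column \<open>j\<close>
  meets only block \<open>j\<close>, whose rows start at \<open>j * m\<close>.\<close>

lemma diag_block_mat_logical_mat:
  assumes "\<And>x. x \<in> set xs \<Longrightarrow> h x < m"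
  shows "diag_block_mat (map (\<lambda>x. logical_mat m 1 (\<lambda>_. h x)) xs) =
    logical_mat (length xs * m) (length xs) (\<lambda>j. j * m + h (xs ! j))"
  using assms
proof (induction xs)
  case Nil
  show ?case by (rule eq_matI) auto
next
  case (Cons x xs)
  let ?h = "\<lambda>j. j * m + h ((x # xs) ! j)"
  have IH: "diag_block_mat (map (\<lambda>x. logical_mat m 1 (\<lambda>_. h x)) xs) =
      logical_mat (length xs * m) (length xs) (\<lambda>j. j * m + h (xs ! j))"
    using Cons by simp
  have hx: "h x < m" using Cons.prems by simp
  show ?case
  proof (rule eq_matI)
    fix i j
    assume "i < dim_row (logical_mat (length (x # xs) * m) (length (x # xs)) ?h)"
      "j < dim_col (logical_mat (length (x # xs) * m) (length (x # xs)) ?h)"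
    then have ij: "i < m + length xs * m" "j < Suc (length xs)" by auto
    show "diag_block_mat (map (\<lambda>x. logical_mat m 1 (\<lambda>_. h x)) (x # xs)) $$ (i, j) =
        logical_mat (length (x # xs) * m) (length (x # xs)) ?h $$ (i, j)"
      \<comment> \<open>Column 0 belongs to the head block; the others are columns of the tail,
        shifted by one column and \<open>m\<close> rows.\<close>
      using ij hx by (cases j) (auto simp: IH[simplified] Let_def)
  qed (auto simp: IH[simplified] Let_def)
qed

text \<open>Column \<open>j\<close> goes to the code of the pair (j, j): this matrix duplicates its
  argument.\<close>

lemma diag_delta_eq_logical_mat: "diag_delta k = logical_mat (k * k) k (\<lambda>j. j * k + j)"
proof -
  have "diag_delta k = diag_block_mat (map (\<lambda>i. logical_mat k 1 (\<lambda>_. i - 1)) [1..<k+1])"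
    unfolding diag_delta_def
    by (rule arg_cong[where f = diag_block_mat], rule map_cong)
      (auto simp: delta_eq_unit_vec col_mat_unit_vec)
  also have "\<dots> = logical_mat (k * k) k (\<lambda>j. j * k + ([1..<k+1] ! j - 1))"
    by (subst diag_block_mat_logical_mat) auto
  also have "\<dots> = logical_mat (k * k) k (\<lambda>j. j * k + j)"
    by (rule logical_mat_cong) (simp del: upt_Suc)
  finally show ?thesis .
qed

lemma length_concat_map_upt:
  assumes "\<And>i. i \<in> {a..<a + m} \<Longrightarrow> length (xs i) = n"
  shows "length (concat (map xs [a..<a + m])) = m * n"
  using assms by (induction m) (auto simp: add.commute)

text \<open>Induction on the number of lists: the position falls either in the earlier lists, of
  total length \<open>m * n\<close>, or in the last one, where \<open>i = m\<close>.\<close>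

lemma nth_concat_map_upt:
  assumes "\<And>i. i \<in> {a..<a + m} \<Longrightarrow> length (xs i) = n" and "i < m" "j < n"
  shows "concat (map xs [a..<a + m]) ! (i * n + j) = xs (a + i) ! j"
  using assms
proof (induction m)
  case (Suc m)
  have l: "length (concat (map xs [a..<a + m])) = m * n"
    using Suc.prems(1) by (intro length_concat_map_upt) auto
  show ?case
  proof (cases "i < m")
    case True
    then have "i * n + j < m * n" using Suc.prems by (intro mult_add_less)
    then show ?thesis using Suc True l by (simp add: nth_append)
  next
    case False
    then have "i = m" using Suc.prems by simp
    then show ?thesis using Suc.prems l by (simp add: nth_append)
  qed
qed simp

text \<open>The code \<open>a * n + b\<close> of (a, b) is sent to \<open>b * m + a\<close>, the
  code of (b, a).\<close>

lemma swap_mat_eq_logical_mat: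
  "swap_mat m n = logical_mat (m * n) (m * n) (\<lambda>j. (j mod n) * m + j div n)"
proof -
  \<comment> \<open>The range is written \<open>1 + m\<close> to fit the form \<open>a + m\<close>
    in the concatenation lemmas.\<close>
  let ?js = "concat (map (\<lambda>i. map (\<lambda>j. j * m + i) [0..<n]) [1..<1 + m])"
  have l: "length ?js = m * n" by (rule length_concat_map_upt) simp
  \<comment> \<open>The label at position \<open>j\<close> is
    \<open>(j mod n) * m + (1 + j div n)\<close>; the subtraction cancels the 1.\<close>
  have nth: "?js ! j - 1 = (j mod n) * m + j div n" if "j < m * n" for j
    using nth_concat_map_upt[of 1 m "\<lambda>i. map (\<lambda>j. j * m + i) [0..<n]" n "j div n" "j mod n"]
      less_mult_imp_div_less[OF that] mod_less_of_less_mult[OF that] by simp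
  have "(j mod n) * m + j div n < m * n" if "j < m * n" for j
    using mult_add_less[OF mod_less_of_less_mult[OF that] less_mult_imp_div_less[OF that]]
    by (simp add: mult.commute)
  then have "delta_mat (m * n) ?js = logical_mat (m * n) (length ?js) (\<lambda>j. ?js ! j - 1)"
    by (intro delta_mat_eq_logical_mat) (simp only: l nth)
  also have "\<dots> = logical_mat (m * n) (m * n) (\<lambda>j. (j mod n) * m + j div n)"
    unfolding l by (rule logical_mat_cong) (rule nth)
  finally show ?thesis by (simp add: swap_mat_def add.commute)
qed

lemma index_block_row:
  assumes "\<And>i. i \<in> {1..n} \<Longrightarrow> B i \<in> carrier_mat m p" and "r < m" "i < n" "j < p"
  shows "block_row m n B $$ (r, i * p + j) = B (Suc i) $$ (r, j)"
proof -
  let ?cs = "concat (map (\<lambda>i. cols (B i)) [1..<1 + n])"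
  have len: "length (cols (B i)) = p" if "i \<in> {1..<1 + n}" for i
    using assms(1)[of i] that by auto
  have l: "length ?cs = n * p" by (rule length_concat_map_upt) (rule len)
  have "?cs ! (i * p + j) = cols (B (1 + i)) ! j"
    by (rule nth_concat_map_upt) (use len assms in auto)
  moreover have "B (Suc i) \<in> carrier_mat m p" using assms(1,3) by auto
  then have "j < length (cols (B (Suc i)))" "col (B (Suc i)) j $ r = B (Suc i) $$ (r, j)"
    using assms(2,4) by auto
  moreover have "block_row m n B = mat_of_cols m ?cs" by (simp add: block_row_def)
  ultimately show ?thesis
    using assms mult_add_less[of i n j p] l
    by (simp add: mat_of_cols_index del: upt_Suc)
qed

text \<open>Block indices count from 1, as in \<^const>\<open>block_row\<close>; column indices count from 0.\<close>

lemma block_eq_logical_mat: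
  assumes "\<And>i. i \<in> {1..n} \<Longrightarrow> B i \<in> carrier_mat m p"
    and "block_row m n B = logical_mat m (n * p) h" and "i < n"
  shows "B (Suc i) = logical_mat m p (\<lambda>j. h (i * p + j))"
proof -
  have "B (Suc i) \<in> carrier_mat m p" using assms(1,3) by auto
  moreover have "B (Suc i) $$ (r, j) = logical_mat m p (\<lambda>j. h (i * p + j)) $$ (r, j)"
    if "r < m" "j < p" for r j
    using index_block_row[of n B m p r i j] mult_add_less[of i n j p] assms that by simp
  ultimately show ?thesis by (intro eq_matI) auto
qed

section \<open>Numbering the elements of \<open>L\<close>\<close>

text \<open>Distinct positions give distinct unit vectors, so \<open>\<phi>\<close> can be followed
  by the inverse of \<open>unit_vec\<close>; the result is a numbering from 0.\<close>

lemma vector_expression_obtain: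
  assumes "vector_expression L \<phi>"
  obtains p where "bij_betw p L {..<card L}" "\<And>x. x \<in> L \<Longrightarrow> \<phi> x = unit_vec (card L) (p x)"
proof -
  let ?u = "unit_vec (card L) :: nat \<Rightarrow> real vec"
  have "inj_on ?u {..<card L}" by (rule inj_onI) (auto simp: unit_vec_eq)
  then have u: "bij_betw ?u {..<card L} (Delta (card L))"
    by (simp add: bij_betw_def Delta_eq)
  have \<phi>: "bij_betw \<phi> L (Delta (card L))" using assms by (simp add: vector_expression_def)
  let ?p = "the_inv_into {..<card L} ?u \<circ> \<phi>"
  have "bij_betw ?p L {..<card L}"
    by (rule bij_betw_trans[OF \<phi> bij_betw_the_inv_into[OF u]])
  moreover have "\<phi> x = ?u (?p x)" if "x \<in> L" for x
    using f_the_inv_into_f_bij_betw[OF u, of "\<phi> x"] bij_betwE[OF \<phi>] that by auto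
  ultimately show thesis by (rule that)
qed

text \<open>The first vector cuts out the block of columns \<open>a * k + j\<close> with
  \<open>j < k\<close>, and the second picks column \<open>b\<close> of that block.\<close>

lemma stp_stp_unit_vec:
  assumes "a < k" "b < k" "\<And>j. j < k * k \<Longrightarrow> h j < m"
  shows "logical_mat m (k * k) h \<ltimes> col_mat (unit_vec k a) \<ltimes> col_mat (unit_vec k b) =
    col_mat (unit_vec m (h (a * k + b)))"
proof -
  have k: "0 < k" using assms(1) by simp
  have "logical_mat m (k * k) h \<ltimes> col_mat (unit_vec k a) = logical_mat m k (\<lambda>j. h (a * k + j mod k))"
    using assms k by (simp add: col_mat_unit_vec stp_logical_mat_dvd[of k k])
  moreover have "logical_mat m k (\<lambda>j. h (a * k + j mod k)) \<ltimes> col_mat (unit_vec k b) =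
      logical_mat m 1 (\<lambda>_. h (a * k + b mod k))"
    using assms k by (simp add: col_mat_unit_vec stp_logical_mat_eq)
  moreover have "h (a * k + b) < m" using assms by (simp add: mult_add_less)
  ultimately show ?thesis using assms(2) by (simp add: col_mat_unit_vec)
qed

text \<open>This transports \<open>f\<close> to indices: the structure equation equates two unit
  vectors, and equal unit vectors have equal positions.\<close>

lemma is_structure_matrix_index:
  assumes "is_structure_matrix L \<phi> f (logical_mat k (k * k) h)" "card L = k"
    and h: "\<And>j. j < k * k \<Longrightarrow> h j < k"
    and p: "bij_betw p L {..<k}" "\<And>x. x \<in> L \<Longrightarrow> \<phi> x = unit_vec k (p x)"
    and f: "f \<in> L \<rightarrow> L \<rightarrow> L" and xy: "x \<in> L" "y \<in> L"
  shows "p (f x y) = h (p x * k + p y)"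
proof -
  have lt: "p z < k" if "z \<in> L" for z using bij_betwE[OF p(1)] that by auto
  have fL: "f x y \<in> L" using f xy by auto
  have hlt: "h (p x * k + p y) < k" using lt xy h by (simp add: mult_add_less)
  have "col_mat (unit_vec k (p (f x y))) = col_mat (unit_vec k (h (p x * k + p y)))"
    using assms(1,2) p(2) fL xy stp_stp_unit_vec[OF lt[OF xy(1)] lt[OF xy(2)], where m = k and h = h] h
    unfolding is_structure_matrix_def by metis
  then have "logical_mat k 1 (\<lambda>_. p (f x y)) = logical_mat k 1 (\<lambda>_. h (p x * k + p y))"
    using lt[OF fL] hlt by (simp add: col_mat_unit_vec)
  then show ?thesis using lt[OF fL] by (simp add: logical_mat_eq_iff)
qed

section \<open>Conditions (i) to (iii) as equations for \<open>h\<close>\<close>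

lemma stp_diag_delta_iff:
  assumes "0 < k" "\<forall>j<k * k. h j < k"
  shows "logical_mat k (k * k) h \<ltimes> diag_delta k = 1\<^sub>m k \<longleftrightarrow> (\<forall>a<k. h (a * k + a) = a)"
proof -
  have "logical_mat k (k * k) h \<ltimes> diag_delta k = logical_mat k k (\<lambda>j. h (j * k + j))"
    unfolding diag_delta_eq_logical_mat
    by (rule stp_logical_mat_eq) (use assms(1) in \<open>auto intro: mult_add_less\<close>)
  then show ?thesis
    unfolding one_mat_eq_logical_mat using assms(2) by (simp add: logical_mat_eq_iff mult_add_less)
qed

text \<open>The product precomposes \<open>h\<close> with the exchange of the two coordinates of a
  code.\<close>

lemma stp_swap_mat_iff:
  assumes "0 < k" "\<forall>j<k * k. h j < k"
  shows "logical_mat k (k * k) h \<ltimes> swap_mat k k = logical_mat k (k * k) h \<longleftrightarrow>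
    (\<forall>a<k. \<forall>b<k. h (b * k + a) = h (a * k + b))"
proof -
  have lt: "(j mod k) * k + j div k < k * k" if "j < k * k" for j
    using mod_less_of_less_mult[OF that] less_mult_imp_div_less[OF that] by (rule mult_add_less)
  have "logical_mat k (k * k) h \<ltimes> swap_mat k k =
      logical_mat k (k * k) (\<lambda>j. h ((j mod k) * k + j div k))"
    unfolding swap_mat_eq_logical_mat
    by (rule stp_logical_mat_eq) (use assms(1) lt in auto)
  moreover have "h ((j mod k) * k + j div k) < k" if "j < k * k" for j
    using assms(2) lt[OF that] by blast
  ultimately show ?thesis by (simp add: logical_mat_eq_iff all_less_mult_iff)
qed

text \<open>Columns now code triples \<open>(a * k + b) * k + c\<close>. On the left the inner
  \<open>M\<close> is enlarged by an identity on its right and combines \<open>a\<close> with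
  \<open>b\<close>; on the right the identity stands first and the inner \<open>M\<close> combines
  \<open>b\<close> with \<open>c\<close>.\<close>

lemma stp_assoc_iff:
  assumes "0 < k" "\<forall>j<k * k. h j < k"
  shows "logical_mat k (k * k) h \<ltimes> logical_mat k (k * k) h =
      logical_mat k (k * k) h \<ltimes> (1\<^sub>m k \<otimes>\<^sub>K logical_mat k (k * k) h) \<longleftrightarrow>
    (\<forall>a<k. \<forall>b<k. \<forall>c<k. h (h (a * k + b) * k + c) = h (a * k + h (b * k + c)))"
proof -
  have 1: "logical_mat k (k * k) h \<ltimes> logical_mat k (k * k) h =
      logical_mat k (k * k * k) (\<lambda>j. h (h (j div k) * k + j mod k))"
    using assms by (intro stp_logical_mat_dvd) auto
  have lt1: "h (h (j div k) * k + j mod k) < k" if "j < k * k * k" for j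
    using assms(2) less_mult_imp_div_less[OF that] mod_less_of_less_mult[OF that]
    by (simp add: mult_add_less)
  have lt2: "(j div (k * k)) * k + h (j mod (k * k)) < k * k" if "j < k * (k * k)" for j
    using assms(2) less_mult_imp_div_less[OF that] mod_less_of_less_mult[OF that]
    by (simp add: mult_add_less)
  have 2: "logical_mat k (k * k) h \<ltimes> (1\<^sub>m k \<otimes>\<^sub>K logical_mat k (k * k) h) =
      logical_mat k (k * k * k) (\<lambda>j. h ((j div (k * k)) * k + h (j mod (k * k))))"
    using assms lt2 by (simp add: kron_one_left stp_logical_mat_eq mult.assoc)
  \<comment> \<open>The same code regrouped as \<open>a * (k * k) + (b * k + c)\<close>, which the
    right-hand side decodes by \<open>k * k\<close>.\<close>
  have d: "((a * k + b) * k + c) div (k * k) = a" "((a * k + b) * k + c) mod (k * k) = b * k + c"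
    if "b < k" "c < k" for a b c
    using eq_mult_add_iff[of "b * k + c" "k * k" "(a * k + b) * k + c" a]
      mult_add_less[OF that] by (simp_all add: algebra_simps)
  show ?thesis
    unfolding 1 2 using lt1 by (simp add: logical_mat_eq_iff all_less_mult_iff d)
qed

theorem proposition2:
  fixes L :: "'a set" and k :: nat and f :: "'a \<Rightarrow> 'a \<Rightarrow> 'a"
    and \<phi> :: "'a \<Rightarrow> real vec" and M :: "real mat" and B :: "nat \<Rightarrow> real mat"
  assumes "finite L" and "card L = k"
    and "f \<in> L \<rightarrow> L \<rightarrow> L"
    and "vector_expression L \<phi>"
    and "is_structure_matrix L \<phi> f M"
    and "\<And>i. i \<in> {1..k} \<Longrightarrow> B i \<in> logical_mats k k"
    and "M = block_row k k B"
  shows "is_lattice L f \<longleftrightarrow>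
     M \<ltimes> diag_delta k = 1\<^sub>m k \<and>
     M \<ltimes> swap_mat k k = M \<and>
     M \<ltimes> M = M \<ltimes> (1\<^sub>m k \<otimes>\<^sub>K M) \<and>
     (\<exists>i\<in>{1..k}. B i = 1\<^sub>m k)"
proof (cases "k = 0")
  \<comment> \<open>\<open>L\<close> and \<open>{1..k}\<close> are both empty, so neither a neutral
    element nor an identity block exists and both sides are false.\<close>
  case True
  then show ?thesis using assms(1,2) by (simp add: is_lattice_def)
next
  case False
  then have k: "0 < k" by simp
  have "M \<in> logical_mats k (k * k)"
    using assms(2,5) by (simp add: is_structure_matrix_def power2_eq_square)
  then obtain h where h: "\<And>j. j < k * k \<Longrightarrow> h j < k" and M: "M = logical_mat k (k * k) h"
    using logical_mats_imp_logical_mat by blast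
  obtain p where p: "bij_betw p L {..<k}" "\<And>x. x \<in> L \<Longrightarrow> \<phi> x = unit_vec k (p x)"
    using vector_expression_obtain[OF assms(4)] assms(2) by metis
  have pf: "p (f x y) = h (p x * k + p y)" if "x \<in> L" "y \<in> L" for x y
    using is_structure_matrix_index[OF assms(5)[unfolded M] assms(2) h p assms(3) that] .
  have fL: "f x y \<in> L" if "x \<in> L" "y \<in> L" for x y using assms(3) that by auto
  have p_eq: "x = y \<longleftrightarrow> p x = p y" if "x \<in> L" "y \<in> L" for x y
    using p(1) that by (auto simp: bij_betw_def inj_on_def)
  have image: "{..<k} = p ` L" using p(1) by (simp add: bij_betw_def)
  \<comment> \<open>Since \<open>p\<close> maps \<open>L\<close> onto \<open>{..<k}\<close>,
    quantifiers over indices become quantifiers over \<open>L\<close>.\<close>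
  have all: "(\<forall>a<k. P a) \<longleftrightarrow> (\<forall>x\<in>L. P (p x))" for P
    using image by (metis (no_types, lifting) image_iff lessThan_iff)
  have ex: "(\<exists>a<k. P a) \<longleftrightarrow> (\<exists>x\<in>L. P (p x))" for P
    using all[of "\<lambda>a. \<not> P a"] by blast
  have Bcarrier: "B i \<in> carrier_mat k k" if "i \<in> {1..k}" for i
    using assms(6)[OF that] by (simp add: logical_mats_def)
  have B: "B (Suc i) = 1\<^sub>m k \<longleftrightarrow> (\<forall>b<k. h (i * k + b) = b)" if "i < k" for i
  proof -
    have "B (Suc i) = logical_mat k k (\<lambda>j. h (i * k + j))"
      using Bcarrier _ that by (rule block_eq_logical_mat) (simp_all add: assms(7)[symmetric] M)
    then show ?thesis
      unfolding one_mat_eq_logical_mat using h that by (simp add: logical_mat_eq_iff mult_add_less)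
  qed
  have "{1..k} = Suc ` {..<k}" by (simp add: image_Suc_lessThan)
  then have iv: "(\<exists>i\<in>{1..k}. B i = 1\<^sub>m k) \<longleftrightarrow> (\<exists>i<k. \<forall>b<k. h (i * k + b) = b)"
    using B by auto
  have h': "\<forall>j<k * k. h j < k" using h by blast
  have idem: "(\<forall>x\<in>L. f x x = x) \<longleftrightarrow> M \<ltimes> diag_delta k = 1\<^sub>m k"
    unfolding M stp_diag_delta_iff[OF k h'] all by (simp add: p_eq fL pf)
  have comm: "(\<forall>x\<in>L. \<forall>y\<in>L. f x y = f y x) \<longleftrightarrow> M \<ltimes> swap_mat k k = M"
    unfolding M stp_swap_mat_iff[OF k h'] all by (auto simp: p_eq fL pf)
  have assoc: "(\<forall>x\<in>L. \<forall>y\<in>L. \<forall>z\<in>L. f (f x y) z = f x (f y z)) \<longleftrightarrow>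
      M \<ltimes> M = M \<ltimes> (1\<^sub>m k \<otimes>\<^sub>K M)"
    unfolding M stp_assoc_iff[OF k h'] all by (simp add: p_eq fL pf)
  \<comment> \<open>Block \<open>Suc i\<close> describes \<open>f e\<close> for the element
    \<open>e\<close> with \<open>p e = i\<close>, so an identity block yields a neutral element on
    the left, while \<open>is_lattice\<close> asks for one on the right.\<close>
  have left_neutral: "(\<exists>e\<in>L. \<forall>w\<in>L. f e w = w) \<longleftrightarrow> (\<exists>i\<in>{1..k}. B i = 1\<^sub>m k)"
    unfolding iv ex all by (simp add: p_eq fL pf)
  have neutral: "(\<exists>e\<in>L. \<forall>w\<in>L. f w e = w) \<longleftrightarrow> (\<exists>i\<in>{1..k}. B i = 1\<^sub>m k)"
    if "M \<ltimes> swap_mat k k = M"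
  proof -
    have "f w e = f e w" if "w \<in> L" "e \<in> L" for w e
      using comm \<open>M \<ltimes> swap_mat k k = M\<close> that by blast
    then have "(\<exists>e\<in>L. \<forall>w\<in>L. f w e = w) \<longleftrightarrow> (\<exists>e\<in>L. \<forall>w\<in>L. f e w = w)"
      by (intro bex_cong ball_cong refl) metis
    then show ?thesis unfolding left_neutral .
  qed
  show ?thesis
    unfolding is_lattice_def idem comm assoc using assms(1,3)
    \<comment> \<open>If condition (ii) fails, so does commutativity, and both sides are false;
      otherwise \<open>neutral\<close> applies.\<close>
    by (cases "M \<ltimes> swap_mat k k = M") (simp_all add: neutral)
qed

end
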